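(* For all $0\le\varepsilon\le1$, $$\Delta(\varepsilon)=\inf\left\{\frac gn:\ n\ge g\ge1\text{ integers},\ \frac{R(g,n)}{n}\ge\varepsilon\right\}.$$
   Context: Let $\lambda$ denote Lebesgue measure on $\mathbb{R}$. A set $C\subseteq\mathbb{R}$ is symmetric if there is a number $c$ such that, for all $x$, $c+x\in C$ if and only if $c-x\in C$. For a measurable set $A$ of reals put $D(A):=\sup\{\lambda(C): C\subseteq A,\ C\text{ measurable and symmetric}\}$, and for $0\le\varepsilon\le1$ define $\Delta(\varepsilon):=\inf\{D(A): A\subseteq[0,1)\text{ measurable},\ \lambda(A)=\varepsilon\}$. A set $S$ of integers is called a $B^\ast[g]$ set if for every integer $m$ there are at most $g$ ordered pairs $(s_1,s_2)\in S\times S$ with $s_1+s_2=m$. $R(g,n)$ denotes the largest cardinality of a $B^\ast[g]$ set contained in $\{1,2,\dots,n\}$. *)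

theory Defs
  imports "HOL-Analysis.Analysis"
begin

definition symmetric_set :: "real set \<Rightarrow> bool" where
  "symmetric_set C \<longleftrightarrow> (\<exists>c. \<forall>x. c + x \<in> C \<longleftrightarrow> c - x \<in> C)"

(* The supremum is taken in the extended nonnegative reals, since it may be infinite
   for an unbounded set A. *)
definition max_symmetric :: "real set \<Rightarrow> ennreal" where
  "max_symmetric A =
     Sup {emeasure lebesgue C | C. C \<subseteq> A \<and> C \<in> sets lebesgue \<and> symmetric_set C}"

definition Delta :: "real \<Rightarrow> ennreal" where
  "Delta \<epsilon> =
     Inf {max_symmetric A | A.
            A \<subseteq> {0..<1} \<and> A \<in> sets lebesgue \<and> emeasure lebesgue A = ennreal \<epsilon>}"

(* The finiteness conjunct is needed because card is 0 on infinite sets. *)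
definition B_star :: "nat \<Rightarrow> int set \<Rightarrow> bool" where
  "B_star g S \<longleftrightarrow>
     (\<forall>m. finite {(s, t). s \<in> S \<and> t \<in> S \<and> s + t = m} \<and>
          card {(s, t). s \<in> S \<and> t \<in> S \<and> s + t = m} \<le> g)"

definition R :: "nat \<Rightarrow> nat \<Rightarrow> nat" where
  "R g n = Max {card S | S. S \<subseteq> {1..int n} \<and> B_star g S}"

end

theory Submission
  imports Defs
begin

text \<open>
  A symmetric subset of \<open>A\<close> with centre \<open>c\<close> lies in \<open>A \<inter> (2c - A)\<close>, and that intersection is itself
  symmetric. So \<open>max_symmetric A\<close> is the supremum over \<open>t\<close> of the measure of \<open>A \<inter> (t - A)\<close>, which is
  the continuous counterpart of the number of ways to write an integer \<open>m\<close> as a sum of two elements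
  of a set \<open>S\<close>. The two sides of the theorem are linked by replacing a set \<open>S \<subseteq> {1..n}\<close> by the union
  of the cells \<open>[(s-1)/n, s/n)\<close> with \<open>s \<in> S\<close>.

  From integers to reals: if \<open>S\<close> is a \<open>B\<^sup>*[g]\<close> set, the overlap of the union of its cells with a
  reflected copy of itself has measure at most \<open>g/n\<close>. The point is that for a
  given \<open>t\<close> only two sums \<open>m\<close> and \<open>m+1\<close> contribute, with weights \<open>1-\<theta>\<close> and \<open>\<theta>\<close>, so that the overlap
  is dominated by a convex combination of two representation counts. Shortening all cells by a
  common factor gives a subset whose measure is exactly \<open>\<epsilon>\<close>.

  From reals to integers: a measurable \<open>A \<subseteq> [0,1)\<close> is covered, up to little measure, by a union of
  cells that protrudes only little from \<open>A\<close>; a few more cells bring the number of cells up to at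
  least \<open>\<epsilon>n\<close>. Reflection at a grid point maps cells to cells, so each
  representation count divided by \<open>n\<close> is at most an overlap of this union, which exceeds the overlap
  of \<open>A\<close> by at most twice the protruding measure.
\<close>

section \<open>Symmetric subsets and reflected overlaps\<close>

definition overlap :: "real set \<Rightarrow> real \<Rightarrow> real set" where
  "overlap A t = {x \<in> A. t - x \<in> A}"

lemma reflection_vimage:
  fixes A :: "real set"
  assumes "A \<in> sets lebesgue"
  shows sets_reflection_vimage: "(\<lambda>x. t - x) -` A \<in> sets lebesgue"
    and emeasure_reflection_vimage: "emeasure lebesgue ((\<lambda>x. t - x) -` A) = emeasure lebesgue A"
proof -
  have "(\<lambda>x::real. t + (-1) * x) \<in> lebesgue \<rightarrow>\<^sub>M lebesgue"
    using lebesgue_affine_measurable[of "\<lambda>x::real. -1" t] by simp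
  from measurable_sets[OF this assms] show "(\<lambda>x. t - x) -` A \<in> sets lebesgue"
    by simp
  have "(\<lambda>x. t - x) -` A = (\<lambda>x. (-1) *\<^sub>R x + t) ` A"
    by (auto simp: image_iff intro!: bexI[where x="t - _"])
  then show "emeasure lebesgue ((\<lambda>x. t - x) -` A) = emeasure lebesgue A"
    using emeasure_lebesgue_affine[of "-1" t A] by simp
qed

lemma overlap_eq_Int: "overlap A t = A \<inter> (\<lambda>x. t - x) -` A"
  by (auto simp: overlap_def)

lemma sets_overlap: "A \<in> sets lebesgue \<Longrightarrow> overlap A t \<in> sets lebesgue"
  by (simp add: overlap_eq_Int sets.Int sets_reflection_vimage)

lemma overlap_mono: "A \<subseteq> B \<Longrightarrow> overlap A t \<subseteq> overlap B t"
  by (auto simp: overlap_def)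

text \<open>Among the symmetric subsets of \<open>A\<close> with centre \<open>t/2\<close> the overlap at \<open>t\<close> is the largest, so the
  supremum over sets becomes a supremum over centres.\<close>

lemma max_symmetric_eq_SUP_overlap:
  assumes "A \<in> sets lebesgue"
  shows "max_symmetric A = (SUP t. emeasure lebesgue (overlap A t))"
proof (rule antisym)
  show "max_symmetric A \<le> (SUP t. emeasure lebesgue (overlap A t))"
    unfolding max_symmetric_def
  proof (rule Sup_least, clarify)
    fix C assume C: "C \<subseteq> A" "C \<in> sets lebesgue" "symmetric_set C"
    then obtain c where c: "\<And>x. c + x \<in> C \<longleftrightarrow> c - x \<in> C"
      by (auto simp: symmetric_set_def)
    have "C \<subseteq> overlap A (2 * c)"
      using c[of "_ - c"] C(1) by (auto simp: overlap_def algebra_simps)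
    then have "emeasure lebesgue C \<le> emeasure lebesgue (overlap A (2 * c))"
      by (intro emeasure_mono sets_overlap assms)
    then show "emeasure lebesgue C \<le> (SUP t. emeasure lebesgue (overlap A t))"
      by (rule order_trans) (rule SUP_upper, simp)
  qed
  show "(SUP t. emeasure lebesgue (overlap A t)) \<le> max_symmetric A"
  proof (rule SUP_least)
    fix t
    have "symmetric_set (overlap A t)"
      unfolding symmetric_set_def overlap_def
      by (rule exI[of _ "t/2"]) (auto simp: field_simps)
    moreover have "overlap A t \<subseteq> A" by (auto simp: overlap_def)
    ultimately show "emeasure lebesgue (overlap A t) \<le> max_symmetric A"
      unfolding max_symmetric_def using sets_overlap[OF assms]
      by (intro Sup_upper) blast
  qed
qed

text \<open>A point of the overlap of \<open>E\<close> that is not in the overlap of \<open>A\<close> is in \<open>E - A\<close> or its mirror image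
  is.\<close>

lemma emeasure_overlap_perturb:
  assumes "A \<in> sets lebesgue" "E \<in> sets lebesgue"
  shows "emeasure lebesgue (overlap E t)
    \<le> emeasure lebesgue (overlap A t) + 2 * emeasure lebesgue (E - A)"
proof -
  let ?V = "(\<lambda>x. t - x) -` (E - A)"
  have D: "E - A \<in> sets lebesgue" using assms by auto
  note V = sets_reflection_vimage[OF D, of t] and O = sets_overlap[OF assms(1), of t]
  have "emeasure lebesgue (overlap E t) \<le> emeasure lebesgue (overlap A t \<union> ((E - A) \<union> ?V))"
    using D V O by (intro emeasure_mono) (auto simp: overlap_def)
  also have "\<dots> \<le> emeasure lebesgue (overlap A t) + emeasure lebesgue ((E - A) \<union> ?V)"
    using D V O by (intro emeasure_subadditive) auto
  also have "emeasure lebesgue ((E - A) \<union> ?V) \<le> emeasure lebesgue (E - A) + emeasure lebesgue ?V"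
    using D V by (intro emeasure_subadditive) auto
  also have "\<dots> = 2 * emeasure lebesgue (E - A)"
    by (simp add: emeasure_reflection_vimage[OF D] mult_2)
  finally show ?thesis by (simp add: add_left_mono)
qed

section \<open>Unions of grid cells\<close>

text \<open>The parameter \<open>\<theta>\<close> is the fraction of each cell that is kept: \<open>\<theta> = 1\<close> gives full cells, and smaller
  values allow the measure of the union to be prescribed exactly.\<close>

definition grid_cells :: "nat \<Rightarrow> real \<Rightarrow> int set \<Rightarrow> real set" where
  "grid_cells n \<theta> S = (\<Union>s\<in>S. {(of_int s - 1) / n ..< (of_int s - 1 + \<theta>) / n})"

lemma mem_full_grid_cells_iff:
  assumes "n > 0"
  shows "x \<in> grid_cells n 1 S \<longleftrightarrow> \<lfloor>n * x\<rfloor> + 1 \<in> S"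
proof -
  have "x \<in> {(of_int s - 1) / n ..< (of_int s - 1 + 1) / n} \<longleftrightarrow> s = \<lfloor>n * x\<rfloor> + 1" for s :: int
  proof -
    have "x \<in> {(of_int s - 1) / n ..< (of_int s - 1 + 1) / n}
        \<longleftrightarrow> of_int (s - 1) \<le> n * x \<and> n * x < of_int (s - 1) + 1"
      using assms by (simp add: field_simps)
    also have "\<dots> \<longleftrightarrow> \<lfloor>n * x\<rfloor> = s - 1" by (simp add: floor_eq_iff)
    finally show ?thesis by linarith
  qed
  then show ?thesis unfolding grid_cells_def by auto
qed

lemma grid_cells_subset_full: "\<theta> \<le> 1 \<Longrightarrow> grid_cells n \<theta> S \<subseteq> grid_cells n 1 S"
  unfolding grid_cells_def by (fastforce intro: less_le_trans divide_right_mono)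

lemma grid_cells_Un: "grid_cells n \<theta> (S \<union> T) = grid_cells n \<theta> S \<union> grid_cells n \<theta> T"
  by (auto simp: grid_cells_def)

lemma full_grid_cells_subset_unit:
  assumes "n > 0" "S \<subseteq> {1..int n}"
  shows "grid_cells n 1 S \<subseteq> {0..<1}"
proof
  fix x assume "x \<in> grid_cells n 1 S"
  then have "\<lfloor>n * x\<rfloor> + 1 \<in> {1..int n}"
    using assms by (auto simp: mem_full_grid_cells_iff)
  then have "0 \<le> \<lfloor>n * x\<rfloor>" "\<lfloor>n * x\<rfloor> < int n" by auto
  then have "0 \<le> n * x" "n * x < n" by (simp_all add: floor_less_iff)
  then show "x \<in> {0..<1}" using assms by (auto simp: zero_le_mult_iff)
qed

lemma sets_grid_cells: "finite S \<Longrightarrow> grid_cells n \<theta> S \<in> sets lebesgue"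
  unfolding grid_cells_def by (intro sets.finite_UN) auto

lemma emeasure_grid_cells:
  fixes \<theta> :: real
  assumes "n > 0" "finite S" "0 \<le> \<theta>" "\<theta> \<le> 1"
  shows "emeasure lebesgue (grid_cells n \<theta> S) = ennreal (card S * \<theta> / n)"
proof -
  let ?I = "\<lambda>s::int. {(of_int s - 1) / n ..< (of_int s - 1 + \<theta>) / n}"
  have "disjoint_family_on ?I S"
  proof (unfold disjoint_family_on_def, intro ballI impI)
    fix a b :: int assume "a \<noteq> b"
    have "s = \<lfloor>n * x\<rfloor> + 1" if "x \<in> ?I s" for x :: real and s :: int
    proof -
      have "x \<in> grid_cells n 1 {s}"
        using that grid_cells_subset_full[of \<theta> n "{s}"] assms by (auto simp: grid_cells_def)
      then show ?thesis using assms by (simp add: mem_full_grid_cells_iff)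
    qed
    then show "?I a \<inter> ?I b = {}" using \<open>a \<noteq> b\<close> by blast
  qed
  then have "emeasure lebesgue (grid_cells n \<theta> S) = (\<Sum>s\<in>S. emeasure lebesgue (?I s))"
    unfolding grid_cells_def using assms by (intro sum_emeasure[symmetric]) auto
  also have "\<dots> = (\<Sum>s\<in>S. ennreal (\<theta> / n))"
    using assms by (intro sum.cong refl) (simp add: divide_right_mono diff_divide_distrib[symmetric])
  also have "\<dots> = ennreal (card S * \<theta> / n)"
    using assms by (subst sum_ennreal) auto
  finally show ?thesis .
qed

section \<open>Representation counts\<close>

lemma B_star_iff_card_summands:
  assumes "finite S"
  shows "B_star g S \<longleftrightarrow> (\<forall>m. card {s \<in> S. m - s \<in> S} \<le> g)"
proof -
  have eq: "{(s, t). s \<in> S \<and> t \<in> S \<and> s + t = m} = (\<lambda>s. (s, m - s)) ` {s \<in> S. m - s \<in> S}" for m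
    by (auto simp: image_iff)
  have "card ((\<lambda>s. (s, m - s)) ` {s \<in> S. m - s \<in> S}) = card {s \<in> S. m - s \<in> S}" for m
    by (rule card_image) (auto simp: inj_on_def)
  then show ?thesis unfolding B_star_def eq using assms by auto
qed

lemma finite_B_star_cards: "finite {card S |S. S \<subseteq> {1..int n} \<and> B_star g S}"
proof (rule finite_subset)
  show "{card S |S. S \<subseteq> {1..int n} \<and> B_star g S} \<subseteq> card ` Pow {1..int n}" by auto
qed simp

lemma card_le_R: "S \<subseteq> {1..int n} \<Longrightarrow> B_star g S \<Longrightarrow> card S \<le> R g n"
  unfolding R_def using finite_B_star_cards by (intro Max_ge) auto

lemma R_attained:
  obtains S where "S \<subseteq> {1..int n}" "B_star g S" "card S = R g n"
proof -
  have "B_star g {}" by (simp add: B_star_def)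
  then have "{card S |S. S \<subseteq> {1..int n} \<and> B_star g S} \<noteq> {}" by blast
  from Max_in[OF finite_B_star_cards this] show ?thesis
    using that by (auto simp: R_def)
qed

section \<open>From integer sets to real sets\<close>

text \<open>Write \<open>nt = k + \<theta>\<close> with \<open>k\<close> an integer and \<open>0 \<le> \<theta> < 1\<close>. If \<open>x\<close> lies in cell \<open>a\<close> and \<open>t - x\<close> in
  cell \<open>b\<close>, then \<open>a + b\<close> is \<open>k + 2\<close> when the fractional part of \<open>nx\<close> is at most \<open>\<theta>\<close>, and \<open>k + 1\<close>
  otherwise. The overlap therefore consists of at most \<open>g\<close> pieces of length \<open>\<theta>/n\<close> and at most
  \<open>g\<close> pieces of length \<open>(1 - \<theta>)/n\<close>.\<close>

lemma emeasure_overlap_full_grid_cells_le: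
  assumes "n > 0" "finite S" "B_star g S"
  shows "emeasure lebesgue (overlap (grid_cells n 1 S) t) \<le> ennreal (g / n)"
proof -
  define k \<theta> where "k = \<lfloor>n * t\<rfloor>" and "\<theta> = n * t - of_int k"
  have \<theta>: "0 \<le> \<theta>" "\<theta> < 1" and nt: "n * t = of_int k + \<theta>"
    unfolding k_def \<theta>_def by linarith+
  define P where "P m = {s \<in> S. m - s \<in> S}" for m
  have P: "finite (P m)" "card (P m) \<le> g" for m
    using assms B_star_iff_card_summands by (auto simp: P_def)
  let ?L = "\<lambda>s::int. {(of_int s - 1) / n .. (of_int s - 1 + \<theta>) / n}"
  let ?U = "\<lambda>s::int. {(of_int s - 1 + \<theta>) / n .. of_int s / n}"
  have sub: "overlap (grid_cells n 1 S) t \<subseteq> (\<Union>s\<in>P (k+2). ?L s) \<union> (\<Union>s\<in>P (k+1). ?U s)"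
  proof
    fix x assume "x \<in> overlap (grid_cells n 1 S) t"
    then have S: "\<lfloor>n * x\<rfloor> + 1 \<in> S" "\<lfloor>n * (t - x)\<rfloor> + 1 \<in> S"
      using assms by (auto simp: overlap_def mem_full_grid_cells_iff)
    have split: "n * (t - x) = of_int (k - \<lfloor>n * x\<rfloor>) + (\<theta> - frac (n * x))"
      using nt by (simp add: frac_def algebra_simps)
    have f: "0 \<le> frac (n * x)" "frac (n * x) < 1" by (simp_all add: frac_lt_1)
    have x: "x = (of_int \<lfloor>n * x\<rfloor> + frac (n * x)) / n"
      using assms by (simp add: frac_def)
    show "x \<in> (\<Union>s\<in>P (k+2). ?L s) \<union> (\<Union>s\<in>P (k+1). ?U s)"
    proof (cases "frac (n * x) \<le> \<theta>")
      case True
      then have "\<lfloor>n * (t - x)\<rfloor> = k - \<lfloor>n * x\<rfloor>"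
        unfolding split using f \<theta> True by (subst floor_eq_iff) linarith
      then have "k + 2 - (\<lfloor>n * x\<rfloor> + 1) = \<lfloor>n * (t - x)\<rfloor> + 1" by simp
      then have "\<lfloor>n * x\<rfloor> + 1 \<in> P (k + 2)"
        using S by (simp only: P_def mem_Collect_eq simp_thms)
      moreover have "x \<in> ?L (\<lfloor>n * x\<rfloor> + 1)"
        using True f assms by (subst (1) x) (auto intro!: divide_right_mono)
      ultimately show ?thesis by blast
    next
      case False
      then have "\<lfloor>n * (t - x)\<rfloor> = k - \<lfloor>n * x\<rfloor> - 1"
        unfolding split using f \<theta> False by (subst floor_eq_iff, unfold of_int_diff of_int_1) linarith
      then have "k + 1 - (\<lfloor>n * x\<rfloor> + 1) = \<lfloor>n * (t - x)\<rfloor> + 1" by simp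
      then have "\<lfloor>n * x\<rfloor> + 1 \<in> P (k + 1)"
        using S by (simp only: P_def mem_Collect_eq simp_thms)
      moreover have "x \<in> ?U (\<lfloor>n * x\<rfloor> + 1)"
        using False f assms by (subst (1) x) (auto intro!: divide_right_mono)
      ultimately show ?thesis by blast
    qed
  qed
  have pieces: "emeasure lebesgue (\<Union>s\<in>P m. J s) \<le> ennreal (g * l)"
    if "\<And>s. J s \<in> sets lebesgue" "\<And>s. emeasure lebesgue (J s) = ennreal l" "0 \<le> l"
    for J :: "int \<Rightarrow> real set" and l :: real and m
  proof -
    have "emeasure lebesgue (\<Union>s\<in>P m. J s) \<le> (\<Sum>s\<in>P m. emeasure lebesgue (J s))"
      using P that by (intro emeasure_subadditive_finite) auto
    also have "\<dots> = ennreal (card (P m) * l)"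
      using that by (simp add: ennreal_mult flip: ennreal_of_nat_eq_real_of_nat)
    also have "\<dots> \<le> ennreal (g * l)"
      using P that by (intro ennreal_leI mult_right_mono) auto
    finally show ?thesis .
  qed
  have "emeasure lebesgue (overlap (grid_cells n 1 S) t)
      \<le> emeasure lebesgue ((\<Union>s\<in>P (k+2). ?L s) \<union> (\<Union>s\<in>P (k+1). ?U s))"
    using P by (intro emeasure_mono sub sets.Un sets.finite_UN) auto
  also have "\<dots> \<le> emeasure lebesgue (\<Union>s\<in>P (k+2). ?L s) + emeasure lebesgue (\<Union>s\<in>P (k+1). ?U s)"
    using P by (intro emeasure_subadditive sets.finite_UN) auto
  also have "\<dots> \<le> ennreal (g * (\<theta> / n)) + ennreal (g * ((1 - \<theta>) / n))"
    using \<theta> assms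
    by (intro add_mono pieces) (auto simp: divide_right_mono diff_divide_distrib[symmetric])
  also have "\<dots> = ennreal (g * (\<theta> / n) + g * ((1 - \<theta>) / n))"
    using \<theta> by (intro ennreal_plus[symmetric]) simp_all
  also have "g * (\<theta> / n) + g * ((1 - \<theta>) / n) = g / n"
    by (simp add: add_divide_distrib[symmetric] algebra_simps)
  finally show ?thesis .
qed

lemma Delta_le_ratio:
  assumes "0 \<le> \<epsilon>" "1 \<le> n" "\<epsilon> \<le> real (R g n) / n"
  shows "Delta \<epsilon> \<le> ennreal (g / n)"
proof -
  obtain S where S: "S \<subseteq> {1..int n}" "B_star g S" "card S = R g n" by (rule R_attained)
  have n: "n > 0" and fin: "finite S" using assms S finite_subset by auto
  \<comment> \<open>If \<open>S\<close> is empty, then \<open>\<epsilon> = 0\<close> and the quotient below takes the harmless value \<open>0\<close>.\<close>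
  define \<theta> where "\<theta> = \<epsilon> * n / card S"
  have \<theta>: "0 \<le> \<theta>" "\<theta> \<le> 1" "card S * \<theta> / n = \<epsilon>"
  proof -
    have le: "\<epsilon> * n \<le> card S" using assms n S(3) by (simp add: field_simps)
    show "0 \<le> \<theta>" using assms by (simp add: \<theta>_def)
    show "\<theta> \<le> 1" using le unfolding \<theta>_def by (intro divide_le_eq_1[THEN iffD2]) linarith
    show "card S * \<theta> / n = \<epsilon>"
      using le n assms(1) unfolding \<theta>_def by (cases "card S = 0") (auto simp: mult_le_0_iff)
  qed
  let ?A = "grid_cells n \<theta> S"
  have meas: "?A \<in> sets lebesgue" using fin by (rule sets_grid_cells)
  have sub: "?A \<subseteq> grid_cells n 1 S" using \<theta> by (intro grid_cells_subset_full)
  have "Delta \<epsilon> \<le> max_symmetric ?A"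
    unfolding Delta_def
  proof (rule Inf_lower, rule CollectI, intro exI conjI)
    show "?A \<subseteq> {0..<1}"
      using sub full_grid_cells_subset_unit[OF n S(1)] by blast
    show "emeasure lebesgue ?A = ennreal \<epsilon>"
      using emeasure_grid_cells[OF n fin \<theta>(1,2)] \<theta>(3) by simp
  qed (simp_all add: meas)
  also have "\<dots> \<le> ennreal (g / n)"
    unfolding max_symmetric_eq_SUP_overlap[OF meas]
  proof (rule SUP_least)
    fix t
    have "emeasure lebesgue (overlap ?A t) \<le> emeasure lebesgue (overlap (grid_cells n 1 S) t)"
      by (intro emeasure_mono overlap_mono sub sets_overlap sets_grid_cells fin)
    also have "\<dots> \<le> ennreal (g / n)"
      by (intro emeasure_overlap_full_grid_cells_le n fin S)
    finally show "emeasure lebesgue (overlap ?A t) \<le> ennreal (g / n)" .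
  qed
  finally show ?thesis .
qed

section \<open>From real sets to integer sets\<close>

text \<open>The reflection \<open>x \<mapsto> (m - 1)/n - x\<close> exchanges the interiors of the cells \<open>s\<close> and \<open>m - s\<close>; only
  the left end points of the cells, a null set, are in the way.\<close>

lemma summands_le_emeasure_overlap:
  assumes "n > 0" "finite S"
  shows "ennreal (card {s \<in> S. m - s \<in> S} / n)
    \<le> emeasure lebesgue (overlap (grid_cells n 1 S) ((of_int m - 1) / n))"
proof -
  define P where "P = {s \<in> S. m - s \<in> S}"
  have P: "finite P" using assms by (simp add: P_def)
  let ?O = "overlap (grid_cells n 1 S) ((of_int m - 1) / n)"
  define N where "N = (\<lambda>s::int. (of_int s - 1) / real n) ` P"
  have null: "N \<in> null_sets lebesgue"
    using P unfolding N_def by (intro null_sets_completionI finite_imp_null_set_lborel finite_imageI)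
  have O: "?O \<in> sets lebesgue" by (intro sets_overlap sets_grid_cells assms)
  have "grid_cells n 1 P \<subseteq> ?O \<union> N"
  proof
    fix x assume "x \<in> grid_cells n 1 P"
    then have xP: "\<lfloor>n * x\<rfloor> + 1 \<in> P" using assms by (simp add: mem_full_grid_cells_iff)
    show "x \<in> ?O \<union> N"
    proof (cases "frac (n * x) = 0")
      case True
      then have "x = (of_int (\<lfloor>n * x\<rfloor> + 1) - 1) / n" using assms by (simp add: frac_def field_simps)
      then have "x \<in> N" unfolding N_def using xP by blast
      then show ?thesis by simp
    next
      case False
      then have f: "0 < frac (n * x)" "frac (n * x) < 1"
        using frac_ge_0[of "n * x"] frac_lt_1[of "n * x"] by linarith+
      have "n * ((of_int m - 1) / n - x) = of_int (m - 1 - \<lfloor>n * x\<rfloor>) - frac (n * x)"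
        using assms by (simp add: frac_def right_diff_distrib diff_divide_distrib)
      then have "\<lfloor>n * ((of_int m - 1) / n - x)\<rfloor> = m - 2 - \<lfloor>n * x\<rfloor>"
        using f by (subst floor_eq_iff) auto
      then have "\<lfloor>n * ((of_int m - 1) / n - x)\<rfloor> + 1 = m - (\<lfloor>n * x\<rfloor> + 1)" by simp
      then have "\<lfloor>n * ((of_int m - 1) / n - x)\<rfloor> + 1 \<in> S"
        using xP by (simp only: P_def mem_Collect_eq simp_thms)
      then show ?thesis
        using xP assms unfolding P_def overlap_def by (simp add: mem_full_grid_cells_iff)
    qed
  qed
  then have "emeasure lebesgue (grid_cells n 1 P) \<le> emeasure lebesgue (?O \<union> N)"
    using O null by (intro emeasure_mono) auto
  also have "\<dots> = emeasure lebesgue ?O" by (rule emeasure_Un_null_set[OF O null])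
  finally show ?thesis
    using emeasure_grid_cells[OF assms(1) P, of 1] by (simp add: P_def)
qed

text \<open>Squeeze \<open>A\<close> between a compact set \<open>K\<close> and an open set \<open>T\<close>. Once the cell length is below the distance
  from \<open>K\<close> to the complement of \<open>T\<close>, the cells meeting \<open>K\<close> cover \<open>K\<close> and stay inside \<open>T\<close>.\<close>

lemma approximate_by_full_grid_cells:
  assumes A: "A \<subseteq> {0..<1}" "A \<in> sets lebesgue" and \<eta>: "\<eta> > 0"
  obtains n0 where "\<And>n. n \<ge> n0 \<Longrightarrow> \<exists>S \<subseteq> {1..int n}.
      emeasure lebesgue (A - grid_cells n 1 S) \<le> ennreal \<eta> \<and>
      emeasure lebesgue (grid_cells n 1 S - A) \<le> ennreal \<eta>"
proof -
  obtain T where T: "open T" "A \<subseteq> T" "T - A \<in> lmeasurable" "emeasure lebesgue (T - A) < ennreal \<eta>"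
    using sets_lebesgue_outer_open[OF A(2) \<eta>] by blast
  obtain K where K: "closed K" "K \<subseteq> A" "A - K \<in> lmeasurable" "emeasure lebesgue (A - K) < ennreal \<eta>"
    using sets_lebesgue_inner_closed[OF A(2) \<eta>] by blast
  have "bounded K"
    by (rule bounded_subset[of "{0..<1}"]) (use A K in auto)
  then have "compact K" using K compact_eq_bounded_closed by blast
  moreover have "closed (- T)" "K \<inter> - T = {}" using T K by auto
  ultimately obtain \<delta> where \<delta>: "\<delta> > 0" "\<And>x y. x \<in> K \<Longrightarrow> y \<notin> T \<Longrightarrow> \<delta> \<le> dist x y"
    using separate_compact_closed[of K "- T"] by auto
  obtain n0 :: nat where n0: "1 / \<delta> < n0" using reals_Archimedean2 by blast
  have "\<exists>S \<subseteq> {1..int n}. emeasure lebesgue (A - grid_cells n 1 S) \<le> ennreal \<eta> \<and>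
      emeasure lebesgue (grid_cells n 1 S - A) \<le> ennreal \<eta>" if "n \<ge> n0" for n
  proof (intro exI conjI)
    have "0 < 1 / \<delta>" using \<delta> by simp
    then have n: "n > 0" "1 / \<delta> < n" using n0 that by linarith+
    define S where "S = (\<lambda>x. \<lfloor>n * x\<rfloor> + 1) ` K"
    show S: "S \<subseteq> {1..int n}"
    proof
      fix s assume "s \<in> S"
      then obtain x :: real where x: "s = \<lfloor>n * x\<rfloor> + 1" "x \<in> K" by (auto simp: S_def)
      then have "0 \<le> x" "x < 1" using A K by auto
      then have "0 \<le> n * x" "n * x < n" using n by auto
      then have "0 \<le> \<lfloor>n * x\<rfloor>" "\<lfloor>n * x\<rfloor> < int n" by (simp, simp add: floor_less_iff)
      then show "s \<in> {1..int n}" using x by auto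
    qed
    have E: "grid_cells n 1 S \<in> sets lebesgue"
      by (rule sets_grid_cells) (use S finite_subset in auto)
    have "K \<subseteq> grid_cells n 1 S" using n by (auto simp: mem_full_grid_cells_iff S_def)
    then have "emeasure lebesgue (A - grid_cells n 1 S) \<le> emeasure lebesgue (A - K)"
      using K by (intro emeasure_mono) auto
    then show "emeasure lebesgue (A - grid_cells n 1 S) \<le> ennreal \<eta>" using K by simp
    have "grid_cells n 1 S \<subseteq> T"
    proof (rule subsetI, rule ccontr)
      fix y assume "y \<in> grid_cells n 1 S" "y \<notin> T"
      then obtain x :: real where x: "x \<in> K" "\<lfloor>n * y\<rfloor> = \<lfloor>n * x\<rfloor>"
        using n by (auto simp: mem_full_grid_cells_iff S_def)
      have "\<bar>n * x - n * y\<bar> < 1" using x(2) by linarith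
      then have "n * dist x y < 1"
        by (simp add: dist_real_def abs_mult flip: right_diff_distrib)
      moreover have "\<delta> \<le> dist x y" using \<delta> x \<open>y \<notin> T\<close> by blast
      then have "n * \<delta> \<le> n * dist x y" by (simp add: mult_left_mono)
      moreover have "1 < n * \<delta>" using n \<delta> by (simp add: field_simps)
      ultimately show False by linarith
    qed
    then have "emeasure lebesgue (grid_cells n 1 S - A) \<le> emeasure lebesgue (T - A)"
      using T by (intro emeasure_mono) auto
    then show "emeasure lebesgue (grid_cells n 1 S - A) \<le> ennreal \<eta>" using T by simp
  qed
  then show ?thesis using that by blast
qed

lemma exists_ratio_near_max_symmetric:
  assumes A: "A \<subseteq> {0..<1}" "A \<in> sets lebesgue" "emeasure lebesgue A = ennreal \<epsilon>"
    and \<epsilon>: "0 \<le> \<epsilon>" "\<epsilon> \<le> 1" and e: "0 < e"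
  obtains g n where "1 \<le> g" "g \<le> n" "\<epsilon> \<le> real (R g n) / n"
    "ennreal (real g / n) \<le> max_symmetric A + ennreal e"
proof -
  \<comment> \<open>The protruding measure will be at most \<open>2\<eta> + 1/n \<le> 3\<eta>\<close>, and it enters twice.\<close>
  define \<eta> where "\<eta> = e / 6"
  have \<eta>: "\<eta> > 0" using e by (simp add: \<eta>_def)
  obtain n0 where n0: "\<And>n. n \<ge> n0 \<Longrightarrow> \<exists>S \<subseteq> {1..int n}.
      emeasure lebesgue (A - grid_cells n 1 S) \<le> ennreal \<eta> \<and>
      emeasure lebesgue (grid_cells n 1 S - A) \<le> ennreal \<eta>"
    using approximate_by_full_grid_cells[OF A(1,2) \<eta>] by blast
  obtain n1 :: nat where n1: "1 / \<eta> < n1" using reals_Archimedean2 by blast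
  define n where "n = max n0 n1"
  have "0 < 1 / \<eta>" using \<eta> by simp
  moreover have "1 / \<eta> < n" using n1 by (simp add: n_def)
  ultimately have "0 < real n" "1 / \<eta> < n" by linarith+
  then have n: "n > 0" "1 / n < \<eta>" using \<eta> by (simp_all add: field_simps)
  obtain S where S: "S \<subseteq> {1..int n}"
      "emeasure lebesgue (A - grid_cells n 1 S) \<le> ennreal \<eta>"
      "emeasure lebesgue (grid_cells n 1 S - A) \<le> ennreal \<eta>"
    using n0[of n] by (auto simp: n_def)
  have finS: "finite S" using S(1) finite_subset by blast
  have E: "grid_cells n 1 S \<in> sets lebesgue" by (rule sets_grid_cells[OF finS])

  have "ennreal \<epsilon> \<le> emeasure lebesgue (grid_cells n 1 S \<union> (A - grid_cells n 1 S))"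
    unfolding A(3)[symmetric] using A(2) E by (intro emeasure_mono) auto
  also have "\<dots> \<le> emeasure lebesgue (grid_cells n 1 S) + emeasure lebesgue (A - grid_cells n 1 S)"
    using A(2) E by (intro emeasure_subadditive) auto
  also have "\<dots> \<le> ennreal (card S / n) + ennreal \<eta>"
    using S(2) emeasure_grid_cells[OF n(1) finS, of 1] by (intro add_mono) auto
  also have "\<dots> = ennreal (card S / n + \<eta>)" using \<eta> by (subst ennreal_plus) auto
  finally have cardS: "\<epsilon> \<le> card S / n + \<eta>"
    using \<eta> by (subst (asm) ennreal_le_iff) (auto intro: add_nonneg_nonneg)

  define N where "N = nat \<lceil>\<epsilon> * n\<rceil>"
  have N: "\<epsilon> * n \<le> N" "N < \<epsilon> * n + 1" using \<epsilon> by (auto simp: N_def) linarith+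
  have "\<epsilon> * n \<le> n" using \<epsilon> by (simp add: mult_left_le_one_le)
  then have "N \<le> n" unfolding N_def by (simp add: ceiling_le_iff)
  have "card S \<le> n" using card_mono[OF _ S(1)] by simp
  then obtain S' where S': "S \<subseteq> S'" "S' \<subseteq> {1..int n}" "card S' = max (card S) N"
    using exists_subset_between[of S "max (card S) N" "{1..int n}"] \<open>N \<le> n\<close> S(1) by auto
  have fin': "finite S'" using S' finite_subset by blast
  have fin: "finite (S' - S)" using fin' by simp
  have E': "grid_cells n 1 S' \<in> sets lebesgue" by (rule sets_grid_cells[OF fin'])

  have "real (card (S' - S)) \<le> n * \<eta> + 1"
  proof -
    have "card (S' - S) = max (card S) N - card S"
      using card_Diff_subset[OF finS S'(1)] S'(3) by simp
    moreover have "\<epsilon> * n \<le> card S + n * \<eta>"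
      using mult_right_mono[OF cardS, of n] n by (simp add: algebra_simps)
    moreover have "0 \<le> n * \<eta>" using \<eta> by simp
    ultimately show ?thesis using N(2) by (auto simp: max_def of_nat_diff)
  qed
  then have "card (S' - S) / n \<le> (n * \<eta> + 1) / n" by (intro divide_right_mono) auto
  also have "\<dots> \<le> 2 * \<eta>" using n by (simp add: add_divide_distrib)
  finally have added: "card (S' - S) / n \<le> 2 * \<eta>" .

  have "grid_cells n 1 S' = grid_cells n 1 S \<union> grid_cells n 1 (S' - S)"
    using S'(1) by (subst grid_cells_Un[symmetric]) (simp add: Un_absorb1)
  then have "emeasure lebesgue (grid_cells n 1 S' - A)
      \<le> emeasure lebesgue ((grid_cells n 1 S - A) \<union> grid_cells n 1 (S' - S))"
    using A(2) E sets_grid_cells[OF fin] by (intro emeasure_mono) auto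
  also have "\<dots> \<le> emeasure lebesgue (grid_cells n 1 S - A) + emeasure lebesgue (grid_cells n 1 (S' - S))"
    using A(2) E sets_grid_cells[OF fin] by (intro emeasure_subadditive) auto
  also have "\<dots> \<le> ennreal \<eta> + ennreal (2 * \<eta>)"
    using S(3) emeasure_grid_cells[OF n(1) fin, of 1] added
    by (intro add_mono) (auto intro: ennreal_leI)
  also have "\<dots> = ennreal (3 * \<eta>)" using \<eta> by (subst ennreal_plus[symmetric]) auto
  finally have prot: "emeasure lebesgue (grid_cells n 1 S' - A) \<le> ennreal (3 * \<eta>)" .

  have counts: "ennreal (card {s \<in> S'. m - s \<in> S'} / n) \<le> max_symmetric A + ennreal e" for m
  proof -
    let ?t = "(of_int m - 1) / real n"
    have "ennreal (card {s \<in> S'. m - s \<in> S'} / n) \<le> emeasure lebesgue (overlap (grid_cells n 1 S') ?t)"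
      by (rule summands_le_emeasure_overlap[OF n(1) fin'])
    also have "\<dots> \<le> emeasure lebesgue (overlap A ?t) + 2 * emeasure lebesgue (grid_cells n 1 S' - A)"
      by (rule emeasure_overlap_perturb[OF A(2) E'])
    also have "\<dots> \<le> max_symmetric A + 2 * ennreal (3 * \<eta>)"
      unfolding max_symmetric_eq_SUP_overlap[OF A(2)]
      by (intro add_mono mult_left_mono prot SUP_upper) auto
    also have "2 * ennreal (3 * \<eta>) = ennreal e"
      using \<eta> by (simp add: mult_2 \<eta>_def flip: ennreal_plus)
    finally show ?thesis .
  qed

  have le_n: "card {s \<in> S'. m - s \<in> S'} \<le> n" for m
    using card_mono[of "{1..int n}" "{s \<in> S'. m - s \<in> S'}"] S'(2) by auto
  then obtain m where m: "\<And>k. card {s \<in> S'. k - s \<in> S'} \<le> card {s \<in> S'. m - s \<in> S'}"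
    using ex_has_greatest_nat[of "\<lambda>_. True" 0 "\<lambda>k. card {s \<in> S'. k - s \<in> S'}" "Suc n"]
    by (auto simp: le_imp_less_Suc)
  \<comment> \<open>The maximum with \<open>1\<close> matters only for empty \<open>S'\<close>; its cost \<open>1/n\<close> is below \<open>e\<close>.\<close>
  define g where "g = max 1 (card {s \<in> S'. m - s \<in> S'})"
  show ?thesis
  proof (rule that)
    show "1 \<le> g" "g \<le> n" using le_n n by (auto simp: g_def)
    have "B_star g S'"
      unfolding B_star_iff_card_summands[OF fin'] g_def using m
      by (auto intro: max.coboundedI2)
    then have "card S' \<le> R g n" using S'(2) by (intro card_le_R)
    then have "\<epsilon> * n \<le> R g n" using N(1) S'(3) by simp
    then show "\<epsilon> \<le> real (R g n) / n" using n by (simp add: field_simps)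
    have "ennreal (1 / n) \<le> ennreal e" using n \<eta> by (intro ennreal_leI) (simp add: \<eta>_def)
    also have "\<dots> \<le> max_symmetric A + ennreal e" by simp
    finally show "ennreal (real g / n) \<le> max_symmetric A + ennreal e"
      using counts[of m] unfolding g_def max_def by auto
  qed
qed

section \<open>The discrete description of \<open>Delta\<close>\<close>

theorem proposition5p3:
  fixes \<epsilon> :: real
  assumes "0 \<le> \<epsilon>" and "\<epsilon> \<le> 1"
  shows "Delta \<epsilon> =
    ennreal (Inf {real g / real n | g n :: nat. 1 \<le> g \<and> g \<le> n \<and> real (R g n) / real n \<ge> \<epsilon>})"
    (is "_ = ennreal (Inf ?X)")
proof (rule antisym)
  have bdd: "bdd_below ?X" by (rule bdd_belowI[of _ 0]) auto
  \<comment> \<open>The pair \<open>g = n = 1\<close> with the set \<open>{1}\<close> is always admissible.\<close>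
  have "B_star 1 {1}" by (subst B_star_iff_card_summands) (auto simp: Collect_conv_if)
  then have "1 \<le> R 1 1" using card_le_R[of "{1}" 1 1] by simp
  then have "\<epsilon> \<le> real (R 1 1) / real 1" using assms by simp
  then have ne: "?X \<noteq> {}" by blast
  have le: "Delta \<epsilon> \<le> ennreal x" if "x \<in> ?X" for x
    using that Delta_le_ratio[OF assms(1)] by fastforce
  show "Delta \<epsilon> \<le> ennreal (Inf ?X)"
  proof -
    obtain x where "x \<in> ?X" using ne by blast
    from le[OF this] obtain d where d: "Delta \<epsilon> = ennreal d" "0 \<le> d"
      by (cases "Delta \<epsilon>") (auto simp: top_unique)
    have "d \<le> Inf ?X"
    proof (rule cInf_greatest[OF ne])
      fix x assume x: "x \<in> ?X"
      then have "0 \<le> x" by auto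
      then show "d \<le> x" using le[OF x] d by simp
    qed
    then show ?thesis unfolding d(1) by (rule ennreal_leI)
  qed
  show "ennreal (Inf ?X) \<le> Delta \<epsilon>"
    unfolding Delta_def
  proof (rule Inf_greatest, clarify)
    fix A assume A: "A \<subseteq> {0..<1::real}" "A \<in> sets lebesgue" "emeasure lebesgue A = ennreal \<epsilon>"
    show "ennreal (Inf ?X) \<le> max_symmetric A"
    proof (rule ennreal_le_epsilon)
      fix e :: real assume "0 < e"
      then obtain g n where gn: "1 \<le> g" "g \<le> n" "\<epsilon> \<le> real (R g n) / n"
          "ennreal (real g / n) \<le> max_symmetric A + ennreal e"
        using exists_ratio_near_max_symmetric[OF A assms] by blast
      then have "Inf ?X \<le> real g / n" by (intro cInf_lower bdd) blast
      then show "ennreal (Inf ?X) \<le> max_symmetric A + ennreal e"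
        using gn(4) by (meson ennreal_leI order_trans)
    qed
  qed
qed

end
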